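(* Let $n\ge 3$ be an integer and let $C_n$ be the cycle on $n$ vertices. Then $$\mathscr{D}_1(C_n)=\begin{cases}0 & \text{if } n\equiv 0 \pmod 4,\\ 2 & \text{if } n\not\equiv 0\pmod 4,\end{cases}\qquad\text{and}\qquad \mathscr{D}_2(C_n)=\begin{cases}0 & \text{if } n\equiv 0\pmod 4,\\ 1 & \text{if } n\equiv 1,3\pmod 4,\\ 2 & \text{if } n\equiv 2\pmod 4.\end{cases}$$
   Context: All graphs are finite and simple. For a graph $G$ and a labelling $f: V(G)\to\{0,1\}$, the induced edge labelling is $\overline{f}(xy)=|f(x)-f(y)|$ for $xy\in E(G)$. For $i\in\{0,1\}$, $v_i(f)$ is the number of vertices with label $i$ and $e_i(f)$ is the number of edges with induced label $i$. Put $\Delta_v(f)=|v_0(f)-v_1(f)|$ and $\Delta_e(f)=|e_0(f)-e_1(f)|$. Define $$\mathscr{D}_1(G)=\min_{f}\{\Delta_v(f)+\Delta_e(f)\},\qquad \mathscr{D}_2(G)=\min_{f:\,\Delta_v(f)\le 1}\{\Delta_e(f)\},$$ where the first minimum is over all labellings $f:V(G)\to\{0,1\}$ and the second is over those with $\Delta_v(f)\le 1$. *)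

theory Defs
  imports "HOL-Library.FuncSet"
begin

record 'a ugraph =
  verts :: "'a set"
  edges :: "'a set set"

definition simple_graph :: "'a ugraph \<Rightarrow> bool" where
  "simple_graph G \<longleftrightarrow> finite (verts G) \<and> (\<forall>e\<in>edges G. e \<subseteq> verts G \<and> card e = 2)"

text \<open>Labellings are extensional functions, so that a finite graph has only finitely many of them.
  Labels are integers in order that the difference in the induced edge labelling does not
  truncate.\<close>

definition labellings :: "'a ugraph \<Rightarrow> ('a \<Rightarrow> int) set" where
  "labellings G = verts G \<rightarrow>\<^sub>E {0, 1}"

definition edge_label :: "('a \<Rightarrow> int) \<Rightarrow> 'a set \<Rightarrow> int" where
  "edge_label f e = (THE k. \<exists>x y. e = {x, y} \<and> k = \<bar>f x - f y\<bar>)"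

lemma edge_label_eq: "edge_label f {x, y} = \<bar>f x - f y\<bar>"
  unfolding edge_label_def
  by (rule the_equality) (auto simp: doubleton_eq_iff)

definition v_count :: "'a ugraph \<Rightarrow> ('a \<Rightarrow> int) \<Rightarrow> int \<Rightarrow> nat" where
  "v_count G f i = card {x \<in> verts G. f x = i}"

definition e_count :: "'a ugraph \<Rightarrow> ('a \<Rightarrow> int) \<Rightarrow> int \<Rightarrow> nat" where
  "e_count G f i = card {e \<in> edges G. edge_label f e = i}"

definition Delta_v :: "'a ugraph \<Rightarrow> ('a \<Rightarrow> int) \<Rightarrow> int" where
  "Delta_v G f = \<bar>int (v_count G f 0) - int (v_count G f 1)\<bar>"

definition Delta_e :: "'a ugraph \<Rightarrow> ('a \<Rightarrow> int) \<Rightarrow> int" where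
  "Delta_e G f = \<bar>int (e_count G f 0) - int (e_count G f 1)\<bar>"

definition D1 :: "'a ugraph \<Rightarrow> int" where
  "D1 G = Min {Delta_v G f + Delta_e G f | f. f \<in> labellings G}"

definition D2 :: "'a ugraph \<Rightarrow> int" where
  "D2 G = Min {Delta_e G f | f. f \<in> labellings G \<and> Delta_v G f \<le> 1}"

text \<open>This is the cycle on \<open>n\<close> vertices for \<open>n \<ge> 3\<close> only: for \<open>n = 1\<close> the only
  edge degenerates to a loop, and for \<open>n = 2\<close> the two edges coincide.\<close>

definition cycle_graph :: "nat \<Rightarrow> nat ugraph" where
  "cycle_graph n = \<lparr>verts = {..<n}, edges = {{i, (i + 1) mod n} | i. i < n}\<rparr>"

lemma simple_graph_cycle_graph:
  assumes "n \<ge> 3"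
  shows "simple_graph (cycle_graph n)"
proof -
  have "(i + 1) mod n \<noteq> i" if "i < n" for i
    using assms that by (cases "i + 1 = n") auto
  then show ?thesis
    using assms by (fastforce simp: simple_graph_def cycle_graph_def)
qed

end

theory Submission
  imports Defs
begin

text \<open>
  Both parameters are computed from one observation: along a closed walk a 0/1-labelling changes
  its value an even number of times.  If \<open>f\<close> has \<open>a\<close> ones and \<open>2 m\<close> edges with induced label 1, then
  \<open>Delta_v f = \<bar>n - 2 a\<bar>\<close> and \<open>Delta_e f = \<bar>n - 4 m\<bar>\<close>.  Hence \<open>Delta_v f\<close> is at
  least the distance from \<open>n\<close> to the nearest multiple of 2, which is \<open>n mod 2\<close>, and
  \<open>Delta_e f\<close> is at least the distance from \<open>n\<close> to the nearest multiple of 4, which is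
  0, 1, 2, 1 for \<open>n\<close> congruent to 0, 1, 2, 3 modulo 4
  (\<open>cycle_Delta_v_ge\<close>, \<open>cycle_Delta_e_ge\<close>).

  The two bounds are attained by a single labelling, because the number of ones and the number of
  label changes can be prescribed separately within the range \<open>1 \<le> j \<le> a \<le> n - j\<close>: reading \<open>j\<close> blocks \<open>01\<close>, then
  \<open>a - j\<close> further ones, then only zeros, gives \<open>a\<close> ones and exactly \<open>2 j\<close> changes
  (\<open>cycle_block_labelling\<close>).  So the minimum of the sum is the sum of the two minima, and
  since the minimal \<open>Delta_v\<close> is at most 1, the constraint in \<open>D2\<close> costs nothing.
\<close>

lemma inj_on_cycle_edges:
  fixes n :: nat
  assumes "n \<ge> 3"
  shows "inj_on (\<lambda>i. {i, (i + 1) mod n}) {..<n}"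
proof (rule inj_onI)
  fix i j
  assume ij: "i \<in> {..<n}" "j \<in> {..<n}" and eq: "{i, (i + 1) mod n} = {j, (j + 1) mod n}"
  have succ: "(k + 1) mod n = (if k + 1 = n then 0 else k + 1)" if "k \<in> {..<n}" for k
    using that by auto
  have "\<not> (i = (j + 1) mod n \<and> j = (i + 1) mod n)"
    unfolding succ[OF ij(1)] succ[OF ij(2)] using assms by (auto split: if_splits)
  with eq show "i = j"
    by (auto simp: doubleton_eq_iff)
qed

text \<open>Since distinct \<open>i\<close> give distinct edges, counting edges amounts to counting positions.\<close>

lemma e_count_cycle:
  assumes "n \<ge> 3"
  shows "e_count (cycle_graph n) f k = card {i \<in> {..<n}. \<bar>f i - f ((i + 1) mod n)\<bar> = k}"
proof -
  let ?I = "{i \<in> {..<n}. \<bar>f i - f ((i + 1) mod n)\<bar> = k}"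
  have "{e \<in> edges (cycle_graph n). edge_label f e = k} = (\<lambda>i. {i, (i + 1) mod n}) ` ?I"
    by (auto simp: cycle_graph_def edge_label_eq)
  moreover have "inj_on (\<lambda>i. {i, (i + 1) mod n}) ?I"
    using inj_on_cycle_edges[OF assms] by (rule inj_on_subset) auto
  ultimately show ?thesis
    by (simp add: e_count_def card_image)
qed

lemma sum_cyclic_shift:
  fixes f :: "nat \<Rightarrow> 'b::comm_monoid_add"
  shows "(\<Sum>i<n. f ((i + 1) mod n)) = (\<Sum>i<n. f i)"
proof (cases n)
  case (Suc m)
  have "(\<Sum>i<m. f ((i + 1) mod Suc m)) = (\<Sum>i<m. f (Suc i))"
    by (rule sum.cong) auto
  then show ?thesis
    unfolding Suc by (subst (2) sum.lessThan_Suc_shift) (simp add: add.commute)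
qed simp

lemma card_zeros_plus_ones:
  fixes g :: "'a \<Rightarrow> int"
  assumes "finite A" and "\<And>i. i \<in> A \<Longrightarrow> g i \<in> {0, 1}"
  shows "card {i \<in> A. g i = 0} + card {i \<in> A. g i = 1} = card A"
proof -
  have "card A = card ({i \<in> A. g i = 0} \<union> {i \<in> A. g i = 1})"
    by (rule arg_cong[of _ _ card]) (use assms(2) in auto)
  also have "\<dots> = card {i \<in> A. g i = 0} + card {i \<in> A. g i = 1}"
    by (rule card_Un_disjoint) (use assms(1) in auto)
  finally show ?thesis ..
qed

lemma card_ones_eq_sum:
  fixes g :: "'a \<Rightarrow> int"
  assumes "finite A" and "\<And>i. i \<in> A \<Longrightarrow> g i \<in> {0, 1}"
  shows "int (card {i \<in> A. g i = 1}) = (\<Sum>i\<in>A. g i)"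
proof -
  have "(\<Sum>i\<in>A. g i) = (\<Sum>i\<in>A. if g i = 1 then 1 else 0)"
    by (rule sum.cong) (use assms(2) in auto)
  also have "\<dots> = int (card {i \<in> A. g i = 1})"
    using assms(1) by (simp add: sum.If_cases Int_def)
  finally show ?thesis ..
qed

lemma labelling_values:
  assumes "f \<in> labellings (cycle_graph n)" "i < n"
  shows "f i \<in> {0, 1}"
  using assms by (auto simp: labellings_def cycle_graph_def)

lemma cycle_edge_values:
  assumes "f \<in> labellings (cycle_graph n)" "i < n"
  shows "\<bar>f i - f ((i + 1) mod n)\<bar> \<in> {0, 1}"
  using labelling_values[OF assms] labelling_values[OF assms(1), of "(i + 1) mod n"] assms(2)
  by auto

lemma cycle_Delta_v:
  assumes "f \<in> labellings (cycle_graph n)"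
  shows "Delta_v (cycle_graph n) f = \<bar>int n - 2 * int (v_count (cycle_graph n) f 1)\<bar>"
proof -
  have "v_count (cycle_graph n) f 0 + v_count (cycle_graph n) f 1 = n"
    using card_zeros_plus_ones[of "{..<n}" f] labelling_values[OF assms]
    by (simp add: v_count_def cycle_graph_def)
  then show ?thesis
    unfolding Delta_v_def by linarith
qed

lemma cycle_Delta_e:
  assumes "n \<ge> 3" "f \<in> labellings (cycle_graph n)"
  shows "Delta_e (cycle_graph n) f = \<bar>int n - 2 * int (e_count (cycle_graph n) f 1)\<bar>"
proof -
  have "e_count (cycle_graph n) f 0 + e_count (cycle_graph n) f 1 = n"
    using card_zeros_plus_ones[of "{..<n}" "\<lambda>i. \<bar>f i - f ((i + 1) mod n)\<bar>"]
      cycle_edge_values[OF assms(2)]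
    by (simp add: e_count_cycle[OF assms(1)])
  then show ?thesis
    unfolding Delta_e_def by linarith
qed

text \<open>Modulo 2 the absolute values may be dropped, and the signed differences around the cycle
  telescope to 0.\<close>

lemma even_e_count_cycle:
  assumes "n \<ge> 3" "f \<in> labellings (cycle_graph n)"
  shows "even (e_count (cycle_graph n) f 1)"
proof -
  have "int (e_count (cycle_graph n) f 1) = (\<Sum>i<n. \<bar>f i - f ((i + 1) mod n)\<bar>)"
    using cycle_edge_values[OF assms(2)]
    by (subst e_count_cycle[OF assms(1)], subst card_ones_eq_sum) auto
  moreover have "even ((\<Sum>i<n. \<bar>f i - f ((i + 1) mod n)\<bar>) - (\<Sum>i<n. f i - f ((i + 1) mod n)))"
    unfolding sum_subtractf[symmetric] by (rule dvd_sum) (auto simp: abs_if)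
  moreover have "(\<Sum>i<n. f i - f ((i + 1) mod n)) = 0"
    using sum_cyclic_shift[of f n] by (simp add: sum_subtractf)
  ultimately show ?thesis
    by (metis diff_zero even_of_nat)
qed

lemma cycle_Delta_v_ge:
  assumes "f \<in> labellings (cycle_graph n)"
  shows "int (n mod 2) \<le> Delta_v (cycle_graph n) f"
  unfolding cycle_Delta_v[OF assms]
proof (cases "even n")
  case False
  then have "int n - 2 * int (v_count (cycle_graph n) f 1) \<noteq> 0"
    by presburger
  with False show "int (n mod 2) \<le> \<bar>int n - 2 * int (v_count (cycle_graph n) f 1)\<bar>"
    by (simp add: odd_iff_mod_2_eq_one)
qed simp

text \<open>The multiple \<open>4 * ((n + 1) div 4)\<close> exceeds \<open>n\<close> by at most 1 and falls short of it
  by at most 2, so no other multiple of 4 is closer.  When \<open>n mod 4 = 2\<close> there are two nearest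
  multiples, and this is the lower one.\<close>

lemma nearest_multiple_of_4:
  "\<bar>int n - 4 * int ((n + 1) div 4)\<bar> \<le> \<bar>int n - 4 * int m\<bar>"
proof -
  have near: "4 * int ((n + 1) div 4) \<le> int n + 1" "int n - 2 \<le> 4 * int ((n + 1) div 4)"
    by linarith+
  consider "m < (n + 1) div 4" | "m = (n + 1) div 4" | "(n + 1) div 4 < m"
    by linarith
  then show ?thesis
    by cases (use near in linarith)+
qed

lemma distance_to_multiple_of_4:
  "\<bar>int n - 4 * int ((n + 1) div 4)\<bar> =
    (if n mod 4 = 0 then 0 else if n mod 4 = 1 \<or> n mod 4 = 3 then 1 else 2)"
proof -
  obtain q r where n: "n = 4 * q + r" and "r < 4"
    by (metis div_mod_decomp mod_less_divisor mult.commute zero_less_numeral)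
  then consider "r = 0" | "r = 1" | "r = 2" | "r = 3"
    by linarith
  then have "(n + 1) div 4 = (if r = 3 then q + 1 else q)"
    by cases (unfold n, simp_all, linarith?)
  then show ?thesis
    using n \<open>r < 4\<close> by auto
qed

lemma cycle_Delta_e_ge:
  assumes "n \<ge> 3" "f \<in> labellings (cycle_graph n)"
  shows "\<bar>int n - 4 * int ((n + 1) div 4)\<bar> \<le> Delta_e (cycle_graph n) f"
proof -
  obtain m where "e_count (cycle_graph n) f 1 = 2 * m"
    using even_e_count_cycle[OF assms] by (elim evenE)
  then have "Delta_e (cycle_graph n) f = \<bar>int n - 4 * int m\<bar>"
    by (simp add: cycle_Delta_e[OF assms])
  then show ?thesis
    using nearest_multiple_of_4 by simp
qed

text \<open>The labelling \<open>01 \<dots> 01 1 \<dots> 1 0 \<dots> 0\<close> with \<open>j\<close> blocks \<open>01\<close>.  The extra ones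
  directly follow the final 1 of the blocks and the extra zeros run into the zero at position 0,
  so neither creates a further change.\<close>

lemma cycle_block_labelling:
  assumes "n \<ge> 3" "1 \<le> j" "j \<le> a" "a + j \<le> n"
  obtains f where "f \<in> labellings (cycle_graph n)"
    and "v_count (cycle_graph n) f 1 = a" and "e_count (cycle_graph n) f 1 = 2 * j"
proof -
  define one where "one i \<longleftrightarrow> (i < 2 * j \<and> odd i) \<or> (2 * j \<le> i \<and> i < a + j)" for i :: nat
  define f :: "nat \<Rightarrow> int" where "f = (\<lambda>i\<in>{..<n}. if one i then 1 else 0)"
  have f: "f i = (if one i then 1 else 0)" if "i < n" for i
    using that by (simp add: f_def)
  have "f \<in> labellings (cycle_graph n)"
    by (auto simp: f_def labellings_def cycle_graph_def)
  moreover have "v_count (cycle_graph n) f 1 = a"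
  proof -
    have "{i. i < n \<and> f i = 1} = (\<lambda>k. 2 * k + 1) ` {..<j} \<union> {2 * j..<a + j}"
      using assms by (auto simp: f one_def elim!: oddE split: if_splits)
    moreover have "card ((\<lambda>k. 2 * k + 1) ` {..<j} \<union> {2 * j..<a + j}) = j + (a - j)"
      by (subst card_Un_disjoint) (auto simp: card_image inj_on_def)
    ultimately show ?thesis
      using assms by (simp add: v_count_def cycle_graph_def)
  qed
  moreover have "e_count (cycle_graph n) f 1 = 2 * j"
  proof -
    \<comment> \<open>Each step inside the blocks is a change; the only other change is the one after the
        final label 1, at position \<open>a + j - 1\<close>.\<close>
    have change: "\<bar>f i - f ((i + 1) mod n)\<bar> = 1 \<longleftrightarrow> i < 2 * j - 1 \<or> i = a + j - 1"
      if "i < n" for i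
    proof (cases "i + 1 = n")
      case True
      then show ?thesis
        using assms by (auto simp: f one_def)
    next
      case False
      with that have "i + 1 < n" by simp
      then have "\<bar>f i - f ((i + 1) mod n)\<bar> = 1 \<longleftrightarrow> one i \<noteq> one (i + 1)"
        by (simp add: f)
      also have "\<dots> \<longleftrightarrow> i < 2 * j - 1 \<or> i = a + j - 1"
      proof -
        consider "i < 2 * j - 1" | "i = 2 * j - 1" | "2 * j \<le> i"
          by linarith
        then show ?thesis
          unfolding one_def using assms(2,3) by cases auto
      qed
      finally show ?thesis .
    qed
    have "{i \<in> {..<n}. \<bar>f i - f ((i + 1) mod n)\<bar> = 1}
        = {i \<in> {..<n}. i < 2 * j - 1 \<or> i = a + j - 1}"
      by (rule Collect_cong) (use change in blast)
    also have "\<dots> = insert (a + j - 1) {..<2 * j - 1}"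
      using assms by auto
    finally show ?thesis
      using assms by (simp add: e_count_cycle)
  qed
  ultimately show thesis
    by (rule that)
qed

text \<open>For \<open>a = n div 2\<close> and \<open>j = (n + 1) div 4\<close> the block labelling meets both lower bounds.
  The bound \<open>n \<ge> 3\<close> is what makes \<open>j\<close> positive.\<close>

lemma cycle_optimal_labelling:
  assumes "n \<ge> 3"
  obtains f where "f \<in> labellings (cycle_graph n)"
    and "Delta_v (cycle_graph n) f = int (n mod 2)"
    and "Delta_e (cycle_graph n) f = \<bar>int n - 4 * int ((n + 1) div 4)\<bar>"
proof -
  have "1 \<le> (n + 1) div 4" "(n + 1) div 4 \<le> n div 2" "n div 2 + (n + 1) div 4 \<le> n"
    using assms by linarith+
  with assms obtain f where f: "f \<in> labellings (cycle_graph n)"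
    and v: "v_count (cycle_graph n) f 1 = n div 2"
    and e: "e_count (cycle_graph n) f 1 = 2 * ((n + 1) div 4)"
    by (rule cycle_block_labelling)
  have "Delta_v (cycle_graph n) f = int (n mod 2)"
    unfolding cycle_Delta_v[OF f] v by (simp add: zmod_int zdiv_int minus_mult_div_eq_mod)
  moreover have "Delta_e (cycle_graph n) f = \<bar>int n - 4 * int ((n + 1) div 4)\<bar>"
    unfolding cycle_Delta_e[OF assms f] e by simp
  ultimately show thesis
    using f that by blast
qed

lemma finite_labellings_cycle: "finite (labellings (cycle_graph n))"
  by (simp add: labellings_def cycle_graph_def finite_PiE)

theorem theorem6p1:
  fixes n :: nat
  assumes "n \<ge> 3"
  shows "D1 (cycle_graph n) = (if n mod 4 = 0 then 0 else 2)
    \<and> D2 (cycle_graph n) =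
        (if n mod 4 = 0 then 0 else if n mod 4 = 1 \<or> n mod 4 = 3 then 1 else 2)"
proof -
  let ?G = "cycle_graph n"
  let ?d = "\<bar>int n - 4 * int ((n + 1) div 4)\<bar>"
  obtain f where f: "f \<in> labellings ?G" "Delta_v ?G f = int (n mod 2)" "Delta_e ?G f = ?d"
    using cycle_optimal_labelling[OF assms] .
  have "D1 ?G = int (n mod 2) + ?d"
    unfolding D1_def
  proof (rule Min_eqI)
    show "finite {Delta_v ?G g + Delta_e ?G g | g. g \<in> labellings ?G}"
      using finite_labellings_cycle by simp
    show "int (n mod 2) + ?d \<le> y"
      if "y \<in> {Delta_v ?G g + Delta_e ?G g | g. g \<in> labellings ?G}" for y
      using that cycle_Delta_v_ge cycle_Delta_e_ge[OF assms] by (auto intro: add_mono)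
    show "int (n mod 2) + ?d \<in> {Delta_v ?G g + Delta_e ?G g | g. g \<in> labellings ?G}"
      using f by force
  qed
  moreover have "D2 ?G = ?d"
    unfolding D2_def
  proof (rule Min_eqI)
    show "finite {Delta_e ?G g | g. g \<in> labellings ?G \<and> Delta_v ?G g \<le> 1}"
      using finite_labellings_cycle by simp
    show "?d \<le> y" if "y \<in> {Delta_e ?G g | g. g \<in> labellings ?G \<and> Delta_v ?G g \<le> 1}" for y
      using that cycle_Delta_e_ge[OF assms] by auto
    have "Delta_v ?G f \<le> 1"
      unfolding f(2) by presburger
    then show "?d \<in> {Delta_e ?G g | g. g \<in> labellings ?G \<and> Delta_v ?G g \<le> 1}"
      using f by force
  qed
  moreover have "int (n mod 2) +
        (if n mod 4 = 0 then 0 else if n mod 4 = 1 \<or> n mod 4 = 3 then 1 else 2)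
      = (if n mod 4 = 0 then 0 else 2)"
    by presburger
  ultimately show ?thesis
    by (simp only: distance_to_multiple_of_4 simp_thms)
qed

end
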